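(* There exists an algorithm that, given a binary cotree $T$ of a cograph $G$ with $n$ vertices, produces an optimal acyclic coloring of $G$ in $O(n)$ time. Moreover, the obtained coloring is also an optimal star coloring of $G$.
   Context: Cographs: a single vertex is a cograph; disjoint unions and joins (disjoint union plus all edges between distinct parts) of cographs are cographs. A cotree of a cograph $G$ is a rooted tree whose leaves correspond bijectively to the vertices of $G$ and whose internal nodes are labeled $\oplus$ or $\cup$, such that two distinct vertices are adjacent iff the lowest common ancestor of their leaves is a $\oplus$-node; it is binary if every internal node has exactly two children. An acyclic coloring is a proper vertex coloring in which the union of any two color classes induces a forest; a star coloring is a proper vertex coloring in which the union of any two color classes induces a disjoint union of stars. Optimal means using the minimum possible number of colors ($\chi_a(G)$, resp. $\chi_s(G)$). *)

theory Defs
  imports Complex_Main "HOL-Library.Landau_Symbols" "HOL-Library.Disjoint_Sets"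
begin

section \<open>Graphs and cographs\<close>

record 'a graph =
  verts :: "'a set"
  edges :: "'a set set"

definition graph_union :: "'a graph \<Rightarrow> 'a graph \<Rightarrow> 'a graph" where
  "graph_union G H = \<lparr>verts = verts G \<union> verts H, edges = edges G \<union> edges H\<rparr>"

definition graph_join :: "'a graph \<Rightarrow> 'a graph \<Rightarrow> 'a graph" where
  "graph_join G H = \<lparr>verts = verts G \<union> verts H,
     edges = edges G \<union> edges H \<union> {{u, v} |u v. u \<in> verts G \<and> v \<in> verts H}\<rparr>"

inductive cograph :: "'a graph \<Rightarrow> bool" where
  single: "cograph \<lparr>verts = {v}, edges = {}\<rparr>"
| union: "\<lbrakk>cograph G; cograph H; verts G \<inter> verts H = {}\<rbrakk> \<Longrightarrow> cograph (graph_union G H)"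
| join: "\<lbrakk>cograph G; cograph H; verts G \<inter> verts H = {}\<rbrakk> \<Longrightarrow> cograph (graph_join G H)"

definition induced :: "'a graph \<Rightarrow> 'a set \<Rightarrow> 'a graph" where
  "induced G S = \<lparr>verts = verts G \<inter> S, edges = {e \<in> edges G. e \<subseteq> S}\<rparr>"

definition is_cycle :: "'a graph \<Rightarrow> 'a list \<Rightarrow> bool" where
  "is_cycle G xs \<longleftrightarrow> length xs \<ge> 3 \<and> distinct xs \<and> set xs \<subseteq> verts G \<and>
     (\<forall>i<length xs. {xs ! i, xs ! (Suc i mod length xs)} \<in> edges G)"

definition forest :: "'a graph \<Rightarrow> bool" where
  "forest G \<longleftrightarrow> (\<nexists>xs. is_cycle G xs)"

text \<open>A star is \<open>K\<^bsub>1,k\<^esub>\<close> with \<open>k \<ge> 0\<close>; in particular a single vertex is a star.\<close>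

definition star :: "'a graph \<Rightarrow> bool" where
  "star G \<longleftrightarrow> (\<exists>c \<in> verts G. edges G = {{c, x} |x. x \<in> verts G - {c}})"

definition disjoint_union_of_stars :: "'a graph \<Rightarrow> bool" where
  "disjoint_union_of_stars G \<longleftrightarrow>
     (\<exists>P. partition_on (verts G) P \<and> (\<forall>A\<in>P. star (induced G A)) \<and>
          edges G = (\<Union>A\<in>P. edges (induced G A)))"


section \<open>Acyclic and star colorings\<close>

definition proper_coloring :: "'a graph \<Rightarrow> ('a \<Rightarrow> nat) \<Rightarrow> bool" where
  "proper_coloring G f \<longleftrightarrow> (\<forall>u v. {u, v} \<in> edges G \<longrightarrow> f u \<noteq> f v)"

definition color_class :: "'a graph \<Rightarrow> ('a \<Rightarrow> nat) \<Rightarrow> nat \<Rightarrow> 'a set" where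
  "color_class G f i = {v \<in> verts G. f v = i}"

definition acyclic_coloring :: "'a graph \<Rightarrow> ('a \<Rightarrow> nat) \<Rightarrow> bool" where
  "acyclic_coloring G f \<longleftrightarrow> proper_coloring G f \<and>
     (\<forall>i \<in> f ` verts G. \<forall>j \<in> f ` verts G. i \<noteq> j \<longrightarrow>
        forest (induced G (color_class G f i \<union> color_class G f j)))"

definition star_coloring :: "'a graph \<Rightarrow> ('a \<Rightarrow> nat) \<Rightarrow> bool" where
  "star_coloring G f \<longleftrightarrow> proper_coloring G f \<and>
     (\<forall>i \<in> f ` verts G. \<forall>j \<in> f ` verts G. i \<noteq> j \<longrightarrow>
        disjoint_union_of_stars (induced G (color_class G f i \<union> color_class G f j)))"

definition num_colors :: "'a graph \<Rightarrow> ('a \<Rightarrow> nat) \<Rightarrow> nat" where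
  "num_colors G f = card (f ` verts G)"

definition acyclic_chromatic_number :: "'a graph \<Rightarrow> nat" where
  "acyclic_chromatic_number G = (LEAST k. \<exists>f. acyclic_coloring G f \<and> num_colors G f = k)"

definition star_chromatic_number :: "'a graph \<Rightarrow> nat" where
  "star_chromatic_number G = (LEAST k. \<exists>f. star_coloring G f \<and> num_colors G f = k)"

definition optimal_acyclic_coloring :: "'a graph \<Rightarrow> ('a \<Rightarrow> nat) \<Rightarrow> bool" where
  "optimal_acyclic_coloring G f \<longleftrightarrow>
     acyclic_coloring G f \<and> num_colors G f = acyclic_chromatic_number G"

definition optimal_star_coloring :: "'a graph \<Rightarrow> ('a \<Rightarrow> nat) \<Rightarrow> bool" where
  "optimal_star_coloring G f \<longleftrightarrow>
     star_coloring G f \<and> num_colors G f = star_chromatic_number G"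


section \<open>Cotrees\<close>

datatype label = Cup | Oplus

datatype 'a cotree = Leaf 'a | Node label "'a cotree list"

primrec leaves :: "'a cotree \<Rightarrow> 'a list" where
  "leaves (Leaf v) = [v]"
| "leaves (Node l ts) = concat (map leaves ts)"

primrec subtrees :: "'a cotree \<Rightarrow> 'a cotree set" where
  "subtrees (Leaf v) = {Leaf v}"
| "subtrees (Node l ts) = insert (Node l ts) (\<Union> (set (map subtrees ts)))"

text \<open>When the leaves are pairwise distinct and every internal node has a child, the nodes of a
  tree correspond to its subtrees, and the ancestors of a leaf to the subtrees containing it.\<close>

definition is_lca :: "'a cotree \<Rightarrow> 'a \<Rightarrow> 'a \<Rightarrow> 'a cotree \<Rightarrow> bool" where
  "is_lca T u v s \<longleftrightarrow> s \<in> subtrees T \<and> u \<in> set (leaves s) \<and> v \<in> set (leaves s) \<and>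
     (\<forall>s' \<in> subtrees s. u \<in> set (leaves s') \<and> v \<in> set (leaves s') \<longrightarrow> s' = s)"

definition is_cotree :: "'a cotree \<Rightarrow> 'a graph \<Rightarrow> bool" where
  "is_cotree T G \<longleftrightarrow>
     (\<forall>l ts. Node l ts \<in> subtrees T \<longrightarrow> ts \<noteq> []) \<and>
     distinct (leaves T) \<and> set (leaves T) = verts G \<and>
     (\<forall>u \<in> verts G. \<forall>v \<in> verts G. u \<noteq> v \<longrightarrow>
        ({u, v} \<in> edges G \<longleftrightarrow> (\<exists>ts. is_lca T u v (Node Oplus ts))))"

definition binary :: "'a cotree \<Rightarrow> bool" where
  "binary T \<longleftrightarrow> (\<forall>l ts. Node l ts \<in> subtrees T \<longrightarrow> length ts = 2)"


section \<open>A word RAM\<close>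

text \<open>
  Programs are structured programs for a unit-cost random access machine with \<open>w\<close>-bit words.
  The memory consists of registers and zero-initialized arrays of words. Both are named by
  constants in the program text, so a program uses only finitely many of them. Arithmetic is
  addition modulo \<open>2 ^ w\<close> and truncated subtraction. Every literal, register read, array access,
  arithmetic operation, comparison, connective and command costs one time unit.
\<close>

datatype aexp =
    Const nat
  | Reg nat
  | Get nat aexp
  | Add aexp aexp
  | Sub aexp aexp

datatype bexp =
    Less aexp aexp
  | Equal aexp aexp
  | Not bexp
  | And bexp bexp

datatype com =
    Skip
  | Assign nat aexp
  | Put nat aexp aexp
  | Seq com com
  | If bexp com com
  | While bexp com

record state =
  regs :: "nat \<Rightarrow> nat"
  arrs :: "nat \<Rightarrow> nat \<Rightarrow> nat"

primrec aval :: "nat \<Rightarrow> aexp \<Rightarrow> state \<Rightarrow> nat" where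
  "aval w (Const k) s = k mod 2 ^ w"
| "aval w (Reg r) s = regs s r"
| "aval w (Get a e) s = arrs s a (aval w e s)"
| "aval w (Add d e) s = (aval w d s + aval w e s) mod 2 ^ w"
| "aval w (Sub d e) s = aval w d s - aval w e s"

primrec acost :: "aexp \<Rightarrow> nat" where
  "acost (Const k) = 1"
| "acost (Reg r) = 1"
| "acost (Get a e) = acost e + 1"
| "acost (Add d e) = acost d + acost e + 1"
| "acost (Sub d e) = acost d + acost e + 1"

primrec bval :: "nat \<Rightarrow> bexp \<Rightarrow> state \<Rightarrow> bool" where
  "bval w (Less d e) s \<longleftrightarrow> aval w d s < aval w e s"
| "bval w (Equal d e) s \<longleftrightarrow> aval w d s = aval w e s"
| "bval w (Not b) s \<longleftrightarrow> \<not> bval w b s"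
| "bval w (And b c) s \<longleftrightarrow> bval w b s \<and> bval w c s"

primrec bcost :: "bexp \<Rightarrow> nat" where
  "bcost (Less d e) = acost d + acost e + 1"
| "bcost (Equal d e) = acost d + acost e + 1"
| "bcost (Not b) = bcost b + 1"
| "bcost (And b c) = bcost b + bcost c + 1"

definition set_reg :: "nat \<Rightarrow> nat \<Rightarrow> state \<Rightarrow> state" where
  "set_reg r x s = s\<lparr>regs := (regs s)(r := x)\<rparr>"

definition set_arr :: "nat \<Rightarrow> nat \<Rightarrow> nat \<Rightarrow> state \<Rightarrow> state" where
  "set_arr a i x s = s\<lparr>arrs := (arrs s)(a := (arrs s a)(i := x))\<rparr>"

text \<open>\<open>exec w P s t s'\<close>: with word size \<open>w\<close>, program \<open>P\<close> started in \<open>s\<close> halts in \<open>s'\<close> after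
  exactly \<open>t\<close> time units.\<close>

inductive exec :: "nat \<Rightarrow> com \<Rightarrow> state \<Rightarrow> nat \<Rightarrow> state \<Rightarrow> bool" for w :: nat where
  Skip: "exec w Skip s 1 s"
| Assign: "exec w (Assign r e) s (acost e + 1) (set_reg r (aval w e s) s)"
| Put: "exec w (Put a d e) s (acost d + acost e + 1) (set_arr a (aval w d s) (aval w e s) s)"
| Seq: "\<lbrakk>exec w P s t s'; exec w Q s' t' s''\<rbrakk> \<Longrightarrow> exec w (Seq P Q) s (t + t' + 1) s''"
| IfTrue: "\<lbrakk>bval w b s; exec w P s t s'\<rbrakk> \<Longrightarrow> exec w (If b P Q) s (bcost b + t + 1) s'"
| IfFalse: "\<lbrakk>\<not> bval w b s; exec w Q s t s'\<rbrakk> \<Longrightarrow> exec w (If b P Q) s (bcost b + t + 1) s'"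
| WhileFalse: "\<not> bval w b s \<Longrightarrow> exec w (While b P) s (bcost b + 1) s"
| WhileTrue: "\<lbrakk>bval w b s; exec w P s t s'; exec w (While b P) s' t' s''\<rbrakk>
    \<Longrightarrow> exec w (While b P) s (bcost b + t + t' + 1) s''"

inductive_cases exec_SkipE: "exec w Skip s t s'"
inductive_cases exec_AssignE: "exec w (Assign r e) s t s'"
inductive_cases exec_PutE: "exec w (Put a d e) s t s'"
inductive_cases exec_SeqE: "exec w (Seq P Q) s t s'"
inductive_cases exec_IfE: "exec w (If b P Q) s t s'"
inductive_cases exec_WhileE: "exec w (While b P) s t s'"

lemma exec_deterministic:
  "exec w P s t s' \<Longrightarrow> exec w P s t' s'' \<Longrightarrow> t' = t \<and> s'' = s'"
proof (induction arbitrary: t' s'' rule: exec.induct)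
  case (Skip s)
  then show ?case by (rule exec_SkipE) simp
next
  case (Assign r e s)
  then show ?case by (rule exec_AssignE) simp
next
  case (Put a d e s)
  then show ?case by (rule exec_PutE) simp
next
  case (Seq P s t1 s1 Q t2 s2)
  from Seq.prems show ?case by (rule exec_SeqE) (metis Seq.IH Suc_eq_plus1)
next
  case (IfTrue b s P t1 s1 Q)
  from IfTrue.prems show ?case by (rule exec_IfE) (metis IfTrue.IH Suc_eq_plus1, metis IfTrue.hyps(1))
next
  case (IfFalse b s Q t1 s1 P)
  from IfFalse.prems show ?case by (rule exec_IfE) (metis IfFalse.hyps(1), metis IfFalse.IH Suc_eq_plus1)
next
  case (WhileFalse b s P)
  from WhileFalse.prems show ?case by (rule exec_WhileE) (simp, metis WhileFalse.hyps(1))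
next
  case (WhileTrue b s P t1 s1 t2 s2)
  from WhileTrue.prems show ?case by (rule exec_WhileE) (metis WhileTrue.hyps(1), metis WhileTrue.IH Suc_eq_plus1)
qed


section \<open>Input and output\<close>

text \<open>A cotree is given in prefix (Polish) notation: one word per node, \<open>0\<close> for a \<open>\<union>\<close>-node,
  \<open>1\<close> for a \<open>\<oplus>\<close>-node, and \<open>v + 2\<close> for the leaf of vertex \<open>v\<close>. For binary cotrees this
  determines the tree.\<close>

primrec label_code :: "label \<Rightarrow> nat" where
  "label_code Cup = 0"
| "label_code Oplus = 1"

primrec encode :: "nat cotree \<Rightarrow> nat list" where
  "encode (Leaf v) = [v + 2]"
| "encode (Node l ts) = label_code l # concat (map encode ts)"

text \<open>Initially array \<open>0\<close> holds the input and register \<open>0\<close> its length.\<close>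

definition input_state :: "nat list \<Rightarrow> state" where
  "input_state xs =
     \<lparr>regs = (\<lambda>r. if r = 0 then length xs else 0),
      arrs = (\<lambda>a i. if a = 0 \<and> i < length xs then xs ! i else 0)\<rparr>"

text \<open>On halting, the color of vertex \<open>v\<close> is entry \<open>v\<close> of array \<open>1\<close>.\<close>

definition output_coloring :: "state \<Rightarrow> nat \<Rightarrow> nat" where
  "output_coloring s v = arrs s 1 v"

end

theory Submission imports Defs begin

text \<open>
  A star coloring is acyclic, so it suffices to bound acyclic colorings from below and to attain the
  bound by a star coloring. In a join, an acyclic coloring is injective on one of the two sides,
  since two repeated colors on opposite sides give a bichromatic 4-cycle; and the two sides share no
  color. Hence at least \<open>chi\<close> colors are needed, where \<open>chi (a \<union> b) = max (chi a) (chi b)\<close> and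
  \<open>chi (a \<oplus> b) = min (chi a + |b|) (chi b + |a|)\<close>. Choosing the better side at each join and
  coloring the other side injectively attains this number, and such a coloring has no bichromatic
  path on four vertices, which makes it a star coloring.

  In prefix notation a subtree with \<open>m\<close> leaves occupies \<open>2 m - 1\<close> cells, so child positions can be
  computed from the numbers of leaves. One sweep from right to left tabulates the numbers of leaves
  and the values of \<open>chi\<close>; a second one from left to right hands intervals of colors down from each
  node to its children.
\<close>

section \<open>Stars and forests\<close>

definition simple_graph :: "'a graph \<Rightarrow> bool" where
  "simple_graph G \<longleftrightarrow> (\<forall>e\<in>edges G. e \<subseteq> verts G \<and> card e = 2)"

definition P4_K3_free :: "'a graph \<Rightarrow> bool" where
  "P4_K3_free G \<longleftrightarrow> (\<forall>a b c d.
     {a, b} \<in> edges G \<and> {b, c} \<in> edges G \<and> {c, d} \<in> edges G \<longrightarrow> a = c \<or> b = d)"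

definition closed_neighborhood :: "'a graph \<Rightarrow> 'a \<Rightarrow> 'a set" where
  "closed_neighborhood G v = insert v {u. {u, v} \<in> edges G}"

text \<open>In a disjoint union of stars these are the centers; both ends of an isolated edge qualify.\<close>

definition locally_dominating :: "'a graph \<Rightarrow> 'a \<Rightarrow> bool" where
  "locally_dominating G c \<longleftrightarrow>
     (\<forall>u\<in>closed_neighborhood G c. closed_neighborhood G u \<subseteq> closed_neighborhood G c)"

lemma simple_graphD:
  assumes "simple_graph G" and "{u, v} \<in> edges G"
  shows "u \<in> verts G" and "v \<in> verts G" and "u \<noteq> v"
  using assms by (auto simp: simple_graph_def)

lemma simple_graphE:
  assumes "simple_graph G" and "e \<in> edges G"
  obtains u v where "e = {u, v}" and "u \<in> verts G" and "v \<in> verts G" and "u \<noteq> v"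
  using assms by (auto simp: simple_graph_def card_2_iff)

lemma simple_graph_eqI:
  assumes "simple_graph G" and "simple_graph H" and V: "verts G = verts H"
    and E: "\<And>u v. u \<in> verts G \<Longrightarrow> v \<in> verts G \<Longrightarrow> u \<noteq> v \<Longrightarrow> {u, v} \<in> edges G \<longleftrightarrow> {u, v} \<in> edges H"
  shows "G = H"
proof -
  have "e \<in> edges G \<longleftrightarrow> e \<in> edges H" for e
    using E simple_graphE[OF assms(1), of e] simple_graphE[OF assms(2), of e] V by metis
  then have "edges G = edges H" by blast
  with V show ?thesis by simp
qed

lemma simple_graph_induced: "simple_graph G \<Longrightarrow> simple_graph (induced G S)"
  by (auto simp: simple_graph_def induced_def)

lemma closed_neighborhood_commute: "u \<in> closed_neighborhood G v \<longleftrightarrow> v \<in> closed_neighborhood G u"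
  by (auto simp: closed_neighborhood_def insert_commute)

lemma edge_imp_closed_neighborhood: "{u, v} \<in> edges G \<Longrightarrow> u \<in> closed_neighborhood G v"
  by (simp add: closed_neighborhood_def)

lemma closed_neighborhood_subset_verts:
  "simple_graph G \<Longrightarrow> v \<in> verts G \<Longrightarrow> closed_neighborhood G v \<subseteq> verts G"
  by (auto simp: closed_neighborhood_def dest: simple_graphD)

lemma locally_dominating_closed_neighborhood_eq:
  assumes "locally_dominating G c" and "locally_dominating G c'"
    and "v \<in> closed_neighborhood G c" and "v \<in> closed_neighborhood G c'"
  shows "closed_neighborhood G c = closed_neighborhood G c'"
proof -
  have "c' \<in> closed_neighborhood G c" "c \<in> closed_neighborhood G c'"
    using assms closed_neighborhood_commute[of v G] unfolding locally_dominating_def by blast+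
  with assms show ?thesis unfolding locally_dominating_def by blast
qed

lemma P4_K3_free_locally_dominated:
  assumes G: "simple_graph G" "P4_K3_free G" and v: "v \<in> verts G"
  obtains c where "c \<in> verts G" and "locally_dominating G c" and "v \<in> closed_neighborhood G c"
proof (cases "locally_dominating G v")
  case True
  with v that show ?thesis by (auto simp: closed_neighborhood_def)
next
  case False
  then obtain u x where uv: "{u, v} \<in> edges G" and xu: "{x, u} \<in> edges G"
    and x: "x \<noteq> v" "{x, v} \<notin> edges G"
    by (auto simp: locally_dominating_def closed_neighborhood_def)
  have "locally_dominating G u"
    unfolding locally_dominating_def
  proof (intro ballI subsetI)
    fix y z assume y: "y \<in> closed_neighborhood G u" and z: "z \<in> closed_neighborhood G y"
    show "z \<in> closed_neighborhood G u"
    proof (rule ccontr)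
      assume "z \<notin> closed_neighborhood G u"
      then have "z \<noteq> u" and "{z, y} \<in> edges G" "{y, u} \<in> edges G"
        using y z by (auto simp: closed_neighborhood_def)
      then have "y = q" if "{u, q} \<in> edges G" for q
        using G(2) that unfolding P4_K3_free_def by blast
      then have "v = x" using uv xu insert_commute[of _ u] by metis
      with x show False by simp
    qed
  qed
  with that show ?thesis
    using simple_graphD[OF G(1) uv] uv by (auto simp: closed_neighborhood_def insert_commute)
qed

lemma star_closed_neighborhood:
  assumes G: "simple_graph G" "P4_K3_free G" and c: "c \<in> verts G"
  shows "star (induced G (closed_neighborhood G c))"
  unfolding star_def
proof (intro bexI equalityI subsetI)
  let ?H = "induced G (closed_neighborhood G c)"
  show "c \<in> verts ?H"
    using c by (simp add: induced_def closed_neighborhood_def)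
  show "e \<in> edges ?H" if "e \<in> {{c, x} |x. x \<in> verts ?H - {c}}" for e
    using that by (auto simp: induced_def closed_neighborhood_def insert_commute)
  fix e assume e: "e \<in> edges ?H"
  obtain u v where uv: "e = {u, v}" "u \<in> verts ?H" "v \<in> verts ?H" "u \<noteq> v"
    using simple_graphE[OF simple_graph_induced[OF G(1)] e] .
  have "u = c \<or> v = c"
  proof (rule ccontr)
    assume "\<not> ?thesis"
    then have "{c, u} \<in> edges G" "{u, v} \<in> edges G" "{v, c} \<in> edges G"
      using e uv by (auto simp: induced_def closed_neighborhood_def insert_commute)
    with G(2) \<open>\<not> ?thesis\<close> show False unfolding P4_K3_free_def by blast
  qed
  with uv show "e \<in> {{c, x} |x. x \<in> verts ?H - {c}}" by auto
qed

lemma P4_K3_free_imp_disjoint_union_of_stars: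
  assumes G: "simple_graph G" "P4_K3_free G"
  shows "disjoint_union_of_stars G"
proof -
  define P where "P = closed_neighborhood G ` {c \<in> verts G. locally_dominating G c}"
  have "partition_on (verts G) P"
  proof (rule partition_onI)
    show "\<Union> P = verts G"
      using closed_neighborhood_subset_verts[OF G(1)] P4_K3_free_locally_dominated[OF G]
      unfolding P_def by blast
    show "disjnt A B" if "A \<in> P" "B \<in> P" "A \<noteq> B" for A B
      using that locally_dominating_closed_neighborhood_eq[of G] unfolding P_def disjnt_def by blast
    show "{} \<notin> P" by (auto simp: P_def closed_neighborhood_def)
  qed
  moreover have "\<exists>A\<in>P. e \<in> edges (induced G A)" if e: "e \<in> edges G" for e
  proof -
    obtain u v where uv: "u \<in> verts G" "e = {u, v}" using simple_graphE[OF G(1) e] .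
    obtain c where c: "c \<in> verts G" "locally_dominating G c" "u \<in> closed_neighborhood G c"
      using P4_K3_free_locally_dominated[OF G uv(1)] .
    moreover have "v \<in> closed_neighborhood G c"
      using c e uv edge_imp_closed_neighborhood[of v u G]
      unfolding locally_dominating_def by (auto simp: insert_commute)
    ultimately show ?thesis using e uv by (auto simp: P_def induced_def)
  qed
  then have "edges G = (\<Union>A\<in>P. edges (induced G A))"
    by (auto simp: induced_def)
  moreover have "\<forall>A\<in>P. star (induced G A)"
    using star_closed_neighborhood[OF G] by (auto simp: P_def)
  ultimately show ?thesis unfolding disjoint_union_of_stars_def by blast
qed

lemma star_imp_P4_K3_free:
  assumes "star G"
  shows "P4_K3_free G"
proof -
  obtain z where z: "edges G = {{z, x} |x. x \<in> verts G - {z}}"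
    using assms unfolding star_def by blast
  have "z \<in> {u, v} \<and> u \<noteq> v" if "{u, v} \<in> edges G" for u v
    using that unfolding z by (auto simp: doubleton_eq_iff)
  then show ?thesis unfolding P4_K3_free_def by blast
qed

lemma disjoint_union_of_stars_imp_P4_K3_free:
  assumes "disjoint_union_of_stars G"
  shows "P4_K3_free G"
  unfolding P4_K3_free_def
proof (intro allI impI)
  fix a b c d assume walk: "{a, b} \<in> edges G \<and> {b, c} \<in> edges G \<and> {c, d} \<in> edges G"
  obtain P where P: "partition_on (verts G) P" "\<forall>A\<in>P. star (induced G A)"
    and edges: "edges G = (\<Union>A\<in>P. edges (induced G A))"
    using assms unfolding disjoint_union_of_stars_def by blast
  have part: "\<exists>A\<in>P. e \<in> edges (induced G A) \<and> e \<subseteq> A" if "e \<in> edges G" for e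
    using that[unfolded edges] by (auto simp: induced_def)
  obtain A B C where A: "A \<in> P" "{a, b} \<in> edges (induced G A)" "{a, b} \<subseteq> A"
    and B: "B \<in> P" "{b, c} \<in> edges (induced G B)" "{b, c} \<subseteq> B"
    and C: "C \<in> P" "{c, d} \<in> edges (induced G C)" "{c, d} \<subseteq> C"
    using walk part[of "{a, b}"] part[of "{b, c}"] part[of "{c, d}"] by auto
  have "b \<in> A \<inter> B" "c \<in> B \<inter> C" using A(3) B(3) C(3) by simp_all
  then have "A = B" "B = C"
    using disjointD[OF partition_onD2[OF P(1)]] A(1) B(1) C(1) by blast+
  moreover have "P4_K3_free (induced G A)" using P(2) A(1) star_imp_P4_K3_free by blast
  ultimately show "a = c \<or> b = d" using A(2) B(2) C(2) unfolding P4_K3_free_def by metis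
qed

lemma P4_K3_free_imp_forest:
  assumes "P4_K3_free G"
  shows "forest G"
  unfolding forest_def
proof
  assume "\<exists>xs. is_cycle G xs"
  then obtain xs where len: "3 \<le> length xs" and dist: "distinct xs"
    and E: "\<And>i. i < length xs \<Longrightarrow> {xs ! i, xs ! (Suc i mod length xs)} \<in> edges G"
    by (auto simp: is_cycle_def)
  define j where "j = 3 mod length xs"
  have j: "j < length xs" "j \<noteq> 1"
    using len by (cases "length xs = 3"; simp add: j_def)+
  have "0 < length xs" "1 < length xs" "2 < length xs" using len by linarith+
  then have "{xs ! 0, xs ! 1} \<in> edges G" "{xs ! 1, xs ! 2} \<in> edges G" "{xs ! 2, xs ! j} \<in> edges G"
    using E[of 0] E[of 1] E[of 2] by (simp_all add: j_def numeral_2_eq_2 numeral_3_eq_3)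
  then have "xs ! 0 = xs ! 2 \<or> xs ! 1 = xs ! j"
    using assms unfolding P4_K3_free_def by blast
  then show False
    using j \<open>0 < length xs\<close> \<open>1 < length xs\<close> \<open>2 < length xs\<close>
    by (simp add: nth_eq_iff_index_eq[OF dist])
qed

section \<open>Colorings of unions and joins\<close>

lemma star_coloring_imp_acyclic_coloring: "star_coloring G f \<Longrightarrow> acyclic_coloring G f"
  by (simp add: star_coloring_def acyclic_coloring_def
      P4_K3_free_imp_forest disjoint_union_of_stars_imp_P4_K3_free)

lemma induced_color_classes_edge_iff:
  assumes "simple_graph G"
  shows "{u, v} \<in> edges (induced G (color_class G f i \<union> color_class G f j)) \<longleftrightarrow>
    {u, v} \<in> edges G \<and> f u \<in> {i, j} \<and> f v \<in> {i, j}"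
  using simple_graphD[OF assms, of u v] by (auto simp: induced_def color_class_def)

lemma star_coloring_iff:
  assumes G: "simple_graph G"
  shows "star_coloring G f \<longleftrightarrow> proper_coloring G f \<and>
    (\<forall>a b c d. {a, b} \<in> edges G \<and> {b, c} \<in> edges G \<and> {c, d} \<in> edges G \<and> f a = f c \<and> f b = f d
       \<longrightarrow> a = c \<or> b = d)"
  (is "_ \<longleftrightarrow> _ \<and> ?no_bichromatic_P4")
proof (intro iffI conjI)
  assume star: "star_coloring G f"
  then show proper: "proper_coloring G f" by (simp add: star_coloring_def)
  show ?no_bichromatic_P4
  proof (intro allI impI)
    fix a b c d
    assume walk: "{a, b} \<in> edges G \<and> {b, c} \<in> edges G \<and> {c, d} \<in> edges G \<and> f a = f c \<and> f b = f d"
    let ?H = "induced G (color_class G f (f a) \<union> color_class G f (f b))"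
    have "a \<in> verts G" "b \<in> verts G" "f a \<noteq> f b"
      using simple_graphD[OF G] proper walk by (auto simp: proper_coloring_def)
    then have "P4_K3_free ?H"
      using star disjoint_union_of_stars_imp_P4_K3_free by (auto simp: star_coloring_def)
    then show "a = c \<or> b = d"
      using walk unfolding P4_K3_free_def induced_color_classes_edge_iff[OF G] by simp
  qed
next
  assume colors: "proper_coloring G f \<and> ?no_bichromatic_P4"
  have "disjoint_union_of_stars (induced G (color_class G f i \<union> color_class G f j))" for i j
  proof (rule P4_K3_free_imp_disjoint_union_of_stars)
    have "f a = f c" if "{a, b} \<in> edges G" "{b, c} \<in> edges G"
      "f a \<in> {i, j}" "f b \<in> {i, j}" "f c \<in> {i, j}" for a b c
    proof -
      have "f a \<noteq> f b" "f b \<noteq> f c" using colors that by (auto simp: proper_coloring_def)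
      with that(3-5) show ?thesis by auto
    qed
    with colors show "P4_K3_free (induced G (color_class G f i \<union> color_class G f j))"
      unfolding P4_K3_free_def induced_color_classes_edge_iff[OF G] by blast
  qed (rule simple_graph_induced[OF G])
  with colors show "star_coloring G f" by (simp add: star_coloring_def)
qed

lemma star_coloring_cong:
  assumes G: "simple_graph G" and fg: "\<And>v. v \<in> verts G \<Longrightarrow> f v = g v"
  shows "star_coloring G f \<longleftrightarrow> star_coloring G g"
proof -
  have "f ` verts G = g ` verts G" "color_class G f = color_class G g"
    using fg by (auto simp: color_class_def fun_eq_iff)
  moreover have "proper_coloring G f \<longleftrightarrow> proper_coloring G g"
    using simple_graphD[OF G] fg unfolding proper_coloring_def by metis
  ultimately show ?thesis by (simp add: star_coloring_def)
qed

lemma verts_graph_union [simp]: "verts (graph_union G H) = verts G \<union> verts H"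
  by (simp add: graph_union_def)

lemma verts_graph_join [simp]: "verts (graph_join G H) = verts G \<union> verts H"
  by (simp add: graph_join_def)

lemma edge_graph_union_iff [simp]:
  "{u, v} \<in> edges (graph_union G H) \<longleftrightarrow> {u, v} \<in> edges G \<or> {u, v} \<in> edges H"
  by (simp add: graph_union_def)

lemma edge_graph_join_iff [simp]:
  "{u, v} \<in> edges (graph_join G H) \<longleftrightarrow> {u, v} \<in> edges G \<or> {u, v} \<in> edges H \<or>
     u \<in> verts G \<and> v \<in> verts H \<or> u \<in> verts H \<and> v \<in> verts G"
  by (auto simp: graph_join_def doubleton_eq_iff)

lemma graph_join_commute: "graph_join G H = graph_join H G"
  by (auto simp: graph_join_def insert_commute)

lemma simple_graph_union:
  "simple_graph G \<Longrightarrow> simple_graph H \<Longrightarrow> simple_graph (graph_union G H)"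
  by (auto simp: simple_graph_def graph_union_def)

lemma simple_graph_join:
  assumes "simple_graph G" and "simple_graph H" and "verts G \<inter> verts H = {}"
  shows "simple_graph (graph_join G H)"
proof -
  have "u \<noteq> v" if "u \<in> verts G" "v \<in> verts H" for u v
    using assms(3) that by blast
  with assms(1,2) show ?thesis by (auto simp: simple_graph_def graph_join_def)
qed

lemma cograph_imp_simple_graph: "cograph G \<Longrightarrow> simple_graph G"
proof (induction rule: cograph.induct)
  case (single v)
  show ?case by (simp add: simple_graph_def)
qed (simp_all add: simple_graph_union simple_graph_join)

lemma star_coloring_union:
  assumes G: "simple_graph G" "star_coloring G f" and H: "simple_graph H" "star_coloring H f"
    and disj: "verts G \<inter> verts H = {}"
  shows "star_coloring (graph_union G H) f"
proof -
  have "proper_coloring (graph_union G H) f"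
    using G(2) H(2) by (simp add: star_coloring_def proper_coloring_def)
  moreover have "\<not> ({x, y} \<in> edges G \<and> {y, z} \<in> edges H)" "\<not> ({x, y} \<in> edges H \<and> {y, z} \<in> edges G)"
    for x y z
    using simple_graphD(1,2)[OF G(1)] simple_graphD(1,2)[OF H(1)] disj by blast+
  ultimately show ?thesis
    using G(2) H(2) unfolding star_coloring_iff[OF G(1)] star_coloring_iff[OF H(1)]
      star_coloring_iff[OF simple_graph_union[OF G(1) H(1)]] edge_graph_union_iff by metis
qed

lemma proper_coloring_join:
  assumes "simple_graph H" and "proper_coloring G f" and "inj_on f (verts H)"
    and "f ` verts G \<inter> f ` verts H = {}"
  shows "proper_coloring (graph_join G H) f"
  unfolding proper_coloring_def edge_graph_join_iff
proof (intro allI impI, elim disjE conjE)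
  fix u v
  show "f u \<noteq> f v" if "{u, v} \<in> edges G"
    using assms(2) that by (simp add: proper_coloring_def)
  show "f u \<noteq> f v" if "{u, v} \<in> edges H"
    using simple_graphD[OF assms(1) that] assms(3) by (auto dest: inj_onD)
  show "f u \<noteq> f v" if "u \<in> verts G" "v \<in> verts H"
    using assms(4) that by blast
  show "f u \<noteq> f v" if "u \<in> verts H" "v \<in> verts G"
    using assms(4) that by (metis disjoint_iff imageI)
qed

text \<open>Two distinct vertices of the same color lie in \<open>G\<close>, hence so does a bichromatic path on four
  vertices.\<close>

lemma star_coloring_join:
  assumes G: "simple_graph G" "star_coloring G f" and H: "simple_graph H" "inj_on f (verts H)"
    and disj: "verts G \<inter> verts H = {}" "f ` verts G \<inter> f ` verts H = {}"
  shows "star_coloring (graph_join G H) f"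
proof -
  note simple_join = simple_graph_join[OF G(1) H(1) disj(1)]
  have no_bichromatic_P4: "a = c \<or> b = d"
    if walk: "{a, b} \<in> edges (graph_join G H)" "{b, c} \<in> edges (graph_join G H)"
      "{c, d} \<in> edges (graph_join G H)" and colors: "f a = f c" "f b = f d" for a b c d
  proof (rule ccontr)
    assume ne: "\<not> (a = c \<or> b = d)"
    have not_in_H: "x \<notin> verts H"
      if "f x = f y" "x \<noteq> y" "y \<in> verts (graph_join G H)" for x y
    proof
      assume "x \<in> verts H"
      moreover from this have "y \<notin> verts H" using H(2) that(1,2) by (meson inj_onD)
      ultimately show False using disj(2) that(1,3) by (auto simp: disjoint_iff)
    qed
    have "{a, b, c, d} \<subseteq> verts (graph_join G H)"
      using simple_graphD(1,2)[OF simple_join] walk by blast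
    then have "a \<notin> verts H" "b \<notin> verts H" "c \<notin> verts H" "d \<notin> verts H"
      using not_in_H[of a c] not_in_H[of c a] not_in_H[of b d] not_in_H[of d b] ne colors by auto
    then have "{a, b} \<in> edges G" "{b, c} \<in> edges G" "{c, d} \<in> edges G"
      using walk simple_graphD(1)[OF H(1)] by auto
    with ne colors G(2) show False unfolding star_coloring_iff[OF G(1)] by blast
  qed
  have "proper_coloring G f" using G(2) by (simp add: star_coloring_def)
  then have "proper_coloring (graph_join G H) f"
    using proper_coloring_join H disj(2) by blast
  with no_bichromatic_P4 show ?thesis unfolding star_coloring_iff[OF simple_join] by blast
qed

lemma forest_mono:
  assumes "verts G \<subseteq> verts H" and "edges G \<subseteq> edges H" and "forest H"
  shows "forest G"
  using assms unfolding forest_def is_cycle_def by (metis subset_iff)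

lemma acyclic_coloring_mono:
  assumes V: "verts G \<subseteq> verts H" and E: "edges G \<subseteq> edges H" and f: "acyclic_coloring H f"
  shows "acyclic_coloring G f"
  unfolding acyclic_coloring_def
proof (intro conjI ballI impI)
  show "proper_coloring G f"
    using E f by (auto simp: acyclic_coloring_def proper_coloring_def)
next
  fix i j assume "i \<in> f ` verts G" "j \<in> f ` verts G" "i \<noteq> j"
  then have "forest (induced H (color_class H f i \<union> color_class H f j))"
    using V f by (auto simp: acyclic_coloring_def)
  moreover have "verts (induced G (color_class G f i \<union> color_class G f j))
      \<subseteq> verts (induced H (color_class H f i \<union> color_class H f j))"
    "edges (induced G (color_class G f i \<union> color_class G f j))
      \<subseteq> edges (induced H (color_class H f i \<union> color_class H f j))"
    using V E by (auto simp: induced_def color_class_def)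
  ultimately show "forest (induced G (color_class G f i \<union> color_class G f j))"
    using forest_mono by blast
qed

lemma acyclic_coloring_join_inj_on:
  assumes f: "acyclic_coloring (graph_join G H) f" and disj: "verts G \<inter> verts H = {}"
  shows "inj_on f (verts G) \<or> inj_on f (verts H)"
proof (rule ccontr)
  assume "\<not> ?thesis"
  then obtain u v x y where uv: "u \<in> verts G" "v \<in> verts G" "u \<noteq> v" "f u = f v"
    and xy: "x \<in> verts H" "y \<in> verts H" "x \<noteq> y" "f x = f y"
    unfolding inj_on_def by blast
  let ?J = "graph_join G H"
  let ?B = "induced ?J (color_class ?J f (f u) \<union> color_class ?J f (f x))"
  have edges: "{{u, x}, {x, v}, {v, y}, {y, u}} \<subseteq> edges ?B"
    using uv xy by (simp add: induced_def color_class_def)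
  have "is_cycle ?B [u, x, v, y]"
    unfolding is_cycle_def
  proof (intro conjI allI impI)
    show "distinct [u, x, v, y]" using uv xy disj by auto
    show "set [u, x, v, y] \<subseteq> verts ?B"
      using uv xy by (simp add: induced_def color_class_def)
    fix i assume "i < length [u, x, v, y]"
    then consider "i = 0" | "i = 1" | "i = 2" | "i = 3" by fastforce
    then show "{[u, x, v, y] ! i, [u, x, v, y] ! (Suc i mod length [u, x, v, y])} \<in> edges ?B"
      using edges by cases simp_all
  qed simp
  moreover have "f u \<noteq> f x"
    using f uv(1) xy(1) by (auto simp: acyclic_coloring_def proper_coloring_def)
  ultimately show False
    using f uv(1) xy(1) by (auto simp: acyclic_coloring_def forest_def)
qed

lemma num_colors_union_ge:
  assumes "finite (verts G)" and "finite (verts H)"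
  shows "max (num_colors G f) (num_colors H f) \<le> num_colors (graph_union G H) f"
  using assms by (auto simp: num_colors_def intro!: card_mono)

lemma num_colors_join:
  assumes "finite (verts G)" and "finite (verts H)" and "proper_coloring (graph_join G H) f"
  shows "num_colors (graph_join G H) f = num_colors G f + num_colors H f"
proof -
  have "f ` verts G \<inter> f ` verts H = {}"
    using assms(3) by (fastforce simp: proper_coloring_def)
  then show ?thesis
    using assms(1,2) by (simp add: num_colors_def image_Un card_Un_disjoint)
qed

lemma num_colors_inj_on: "inj_on f (verts G) \<Longrightarrow> num_colors G f = card (verts G)"
  by (simp add: num_colors_def card_image)

lemma optimal_coloringsI:
  assumes f: "star_coloring G f"
    and lower: "\<And>g. acyclic_coloring G g \<Longrightarrow> num_colors G f \<le> num_colors G g"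
  shows "optimal_acyclic_coloring G f" and "optimal_star_coloring G f"
proof -
  have "acyclic_chromatic_number G = num_colors G f"
    unfolding acyclic_chromatic_number_def
    using lower star_coloring_imp_acyclic_coloring[OF f] by (auto intro!: Least_equality)
  then show "optimal_acyclic_coloring G f"
    using star_coloring_imp_acyclic_coloring[OF f] by (simp add: optimal_acyclic_coloring_def)
  have "star_chromatic_number G = num_colors G f"
    unfolding star_chromatic_number_def
    using lower star_coloring_imp_acyclic_coloring f by (auto intro!: Least_equality)
  with f show "optimal_star_coloring G f"
    by (simp add: optimal_star_coloring_def)
qed

section \<open>Binary cotrees\<close>

datatype (leaf_set: 'a) bcotree = BLeaf 'a | BNode label "'a bcotree" "'a bcotree"

primrec cotree_of :: "'a bcotree \<Rightarrow> 'a cotree" where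
  "cotree_of (BLeaf v) = Leaf v"
| "cotree_of (BNode l a b) = Node l [cotree_of a, cotree_of b]"

primrec graph_of :: "'a bcotree \<Rightarrow> 'a graph" where
  "graph_of (BLeaf v) = \<lparr>verts = {v}, edges = {}\<rparr>"
| "graph_of (BNode l a b) =
     (case l of Cup \<Rightarrow> graph_union | Oplus \<Rightarrow> graph_join) (graph_of a) (graph_of b)"

primrec order :: "'a bcotree \<Rightarrow> nat" where
  "order (BLeaf v) = 1"
| "order (BNode l a b) = order a + order b"

primrec disjoint_leaves :: "'a bcotree \<Rightarrow> bool" where
  "disjoint_leaves (BLeaf v) \<longleftrightarrow> True"
| "disjoint_leaves (BNode l a b) \<longleftrightarrow>
     disjoint_leaves a \<and> disjoint_leaves b \<and> leaf_set a \<inter> leaf_set b = {}"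

lemma finite_leaf_set [simp]: "finite (leaf_set t)"
  by (induction t) auto

lemma order_pos [simp]: "0 < order t"
  by (induction t) auto

lemma card_leaf_set: "disjoint_leaves t \<Longrightarrow> card (leaf_set t) = order t"
  by (induction t) (auto simp: card_Un_disjoint)

lemma verts_graph_of [simp]: "verts (graph_of t) = leaf_set t"
  by (induction t) (auto split: label.split)

lemma simple_graph_graph_of: "disjoint_leaves t \<Longrightarrow> simple_graph (graph_of t)"
proof (induction t)
  case (BLeaf v)
  show ?case by (simp add: simple_graph_def)
next
  case (BNode l a b)
  then show ?case by (cases l) (simp_all add: simple_graph_union simple_graph_join)
qed

lemma set_leaves_cotree_of [simp]: "set (leaves (cotree_of t)) = leaf_set t"
  by (induction t) auto

lemma distinct_leaves_cotree_of: "distinct (leaves (cotree_of t)) \<longleftrightarrow> disjoint_leaves t"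
  by (induction t) auto

lemma binary_imp_cotree_of: "binary T \<Longrightarrow> \<exists>t. T = cotree_of t"
proof (induction T)
  case (Leaf x)
  have "Leaf x = cotree_of (BLeaf x)" by simp
  then show ?case ..
next
  case (Node l ts)
  have "length ts = 2" using Node.prems by (auto simp: binary_def)
  then obtain A B where ts: "ts = [A, B]"
    by (auto simp: numeral_2_eq_2 length_Suc_conv)
  have "binary A" "binary B" using Node.prems by (auto simp: binary_def ts)
  then obtain a b where "A = cotree_of a" "B = cotree_of b"
    using Node.IH[of A] Node.IH[of B] ts by auto
  then have "Node l ts = cotree_of (BNode l a b)" using ts by simp
  then show ?case ..
qed

lemma self_in_subtrees: "T \<in> subtrees T"
  by (cases T) auto

lemma leaves_subtrees: "S \<in> subtrees T \<Longrightarrow> set (leaves S) \<subseteq> set (leaves T)"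
  by (induction T) auto

lemma is_lca_Node:
  "is_lca (Node l ts) u v S \<longleftrightarrow> (\<exists>T\<in>set ts. is_lca T u v S) \<or>
     S = Node l ts \<and> {u, v} \<subseteq> set (leaves S) \<and> (\<forall>T\<in>set ts. \<not> {u, v} \<subseteq> set (leaves T))"
  (is "?L \<longleftrightarrow> ?R")
proof
  assume L: ?L
  show ?R
  proof (cases "S = Node l ts")
    case True
    have "\<not> {u, v} \<subseteq> set (leaves T)" if T: "T \<in> set ts" for T
    proof
      have "T \<in> subtrees S" using T self_in_subtrees[of T] True by auto
      moreover assume "{u, v} \<subseteq> set (leaves T)"
      ultimately have "T = S" using L by (simp add: is_lca_def)
      then show False using size_list_estimation'[OF T order_refl, of size] True by auto
    qed
    with L True show ?thesis by (simp add: is_lca_def)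
  next
    case False
    with L show ?thesis by (auto simp: is_lca_def)
  qed
next
  assume ?R
  then show ?L
    unfolding is_lca_def using leaves_subtrees by fastforce
qed

lemma edge_graph_of_iff_lca:
  "disjoint_leaves t \<Longrightarrow>
     {u, v} \<in> edges (graph_of t) \<longleftrightarrow> (\<exists>ts. is_lca (cotree_of t) u v (Node Oplus ts))"
proof (induction t)
  case (BLeaf x)
  then show ?case by (simp add: is_lca_def)
next
  case (BNode l a b)
  have "(\<exists>ts. is_lca (cotree_of (BNode l a b)) u v (Node Oplus ts)) \<longleftrightarrow>
    {u, v} \<in> edges (graph_of a) \<or> {u, v} \<in> edges (graph_of b) \<or>
    l = Oplus \<and> {u, v} \<subseteq> leaf_set a \<union> leaf_set b \<and> \<not> {u, v} \<subseteq> leaf_set a \<and> \<not> {u, v} \<subseteq> leaf_set b"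
    using BNode by (auto simp: is_lca_Node)
  then show ?case using BNode.prems by (cases l) auto
qed

lemma is_cotree_imp_graph_of:
  assumes "simple_graph G" and T: "is_cotree (cotree_of t) G"
  shows "disjoint_leaves t" and "G = graph_of t"
proof -
  show d: "disjoint_leaves t"
    using T by (simp add: is_cotree_def distinct_leaves_cotree_of)
  show "G = graph_of t"
    using assms(1) simple_graph_graph_of[OF d]
    by (rule simple_graph_eqI) (use T in \<open>auto simp: is_cotree_def edge_graph_of_iff_lca[OF d]\<close>)
qed

section \<open>An optimal coloring\<close>

primrec chi :: "'a bcotree \<Rightarrow> nat" where
  "chi (BLeaf v) = 1"
| "chi (BNode l a b) =
     (case l of Cup \<Rightarrow> max (chi a) (chi b) | Oplus \<Rightarrow> min (chi a + order b) (chi b + order a))"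

lemma chi_le_order: "chi t \<le> order t"
  by (induction t) (auto split: label.split)

lemma chi_le_num_colors:
  "disjoint_leaves t \<Longrightarrow> acyclic_coloring (graph_of t) f \<Longrightarrow> chi t \<le> num_colors (graph_of t) f"
proof (induction t)
  case (BLeaf v)
  then show ?case by (simp add: num_colors_def)
next
  case (BNode l a b)
  have "acyclic_coloring (graph_of a) f" "acyclic_coloring (graph_of b) f"
    by (rule acyclic_coloring_mono[OF _ _ BNode.prems(2)];
        cases l; auto simp: graph_union_def graph_join_def)+
  then have IH: "chi a \<le> num_colors (graph_of a) f" "chi b \<le> num_colors (graph_of b) f"
    using BNode by simp_all
  show ?case
  proof (cases l)
    case Cup
    then show ?thesis
      using IH num_colors_union_ge[of "graph_of a" "graph_of b" f] by simp
  next
    case Oplus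
    then have f: "acyclic_coloring (graph_join (graph_of a) (graph_of b)) f"
      using BNode.prems(2) by simp
    then have "num_colors (graph_join (graph_of a) (graph_of b)) f =
        num_colors (graph_of a) f + num_colors (graph_of b) f"
      by (intro num_colors_join) (simp_all add: acyclic_coloring_def)
    moreover have "num_colors (graph_of a) f = order a \<or> num_colors (graph_of b) f = order b"
      using acyclic_coloring_join_inj_on[OF f] BNode.prems(1) num_colors_inj_on[of f "graph_of a"]
        num_colors_inj_on[of f "graph_of b"] by (auto simp: card_leaf_set)
    ultimately show ?thesis using IH Oplus by auto
  qed
qed

text \<open>\<open>color t r k\<close> uses the colors from \<open>k\<close> on: a different one for each leaf if \<open>r\<close>, and \<open>chi t\<close>
  many otherwise.\<close>

definition ncolors :: "bool \<Rightarrow> 'a bcotree \<Rightarrow> nat" where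
  "ncolors r t = (if r then order t else chi t)"

definition rainbow_left :: "bool \<Rightarrow> label \<Rightarrow> 'a bcotree \<Rightarrow> 'a bcotree \<Rightarrow> bool" where
  "rainbow_left r l a b \<longleftrightarrow> r \<or> l = Oplus \<and> chi b + order a \<le> chi a + order b"

definition rainbow_right :: "bool \<Rightarrow> label \<Rightarrow> 'a bcotree \<Rightarrow> 'a bcotree \<Rightarrow> bool" where
  "rainbow_right r l a b \<longleftrightarrow> r \<or> l = Oplus \<and> chi a + order b < chi b + order a"

definition right_offset :: "bool \<Rightarrow> label \<Rightarrow> 'a bcotree \<Rightarrow> 'a bcotree \<Rightarrow> nat \<Rightarrow> nat" where
  "right_offset r l a b k = (if r \<or> l = Oplus then k + ncolors (rainbow_left r l a b) a else k)"

primrec color :: "'a bcotree \<Rightarrow> bool \<Rightarrow> nat \<Rightarrow> 'a \<Rightarrow> nat" where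
  "color (BLeaf x) r k v = k"
| "color (BNode l a b) r k v =
     (if v \<in> leaf_set a then color a (rainbow_left r l a b) k v
      else color b (rainbow_right r l a b) (right_offset r l a b k) v)"

lemmas color_defs = rainbow_left_def rainbow_right_def right_offset_def ncolors_def

lemma ncolors_le_order: "ncolors r t \<le> order t"
  by (simp add: ncolors_def chi_le_order)

lemma ncolors_BNode:
  "k + ncolors r (BNode l a b) = max (k + ncolors (rainbow_left r l a b) a)
     (right_offset r l a b k + ncolors (rainbow_right r l a b) b)"
  by (cases l) (auto simp: color_defs)

lemma color_image: "disjoint_leaves t \<Longrightarrow> color t r k ` leaf_set t = {k..<k + ncolors r t}"
proof (induction t arbitrary: r k)
  case (BLeaf x)
  then show ?case by (auto simp: ncolors_def)
next
  case (BNode l a b)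
  let ?ra = "rainbow_left r l a b" and ?rb = "rainbow_right r l a b"
  let ?kb = "right_offset r l a b k"
  have "color (BNode l a b) r k ` leaf_set (BNode l a b) =
      color a ?ra k ` leaf_set a \<union> color b ?rb ?kb ` leaf_set b"
    using BNode.prems by (auto simp: image_Un intro!: image_cong arg_cong2[where f = "(\<union>)"])
  also have "\<dots> = {k..<k + ncolors ?ra a} \<union> {?kb..<?kb + ncolors ?rb b}"
    using BNode by simp
  also have "\<dots> = {k..<k + ncolors r (BNode l a b)}"
    unfolding ncolors_BNode by (auto simp: right_offset_def)
  finally show ?case .
qed

lemma inj_on_color_rainbow: "disjoint_leaves t \<Longrightarrow> inj_on (color t True k) (leaf_set t)"
  by (rule eq_card_imp_inj_on) (simp_all add: color_image card_leaf_set ncolors_def)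

lemma color_BNode:
  assumes "disjoint_leaves (BNode l a b)"
  shows "v \<in> leaf_set a \<Longrightarrow> color (BNode l a b) r k v = color a (rainbow_left r l a b) k v"
    and "v \<in> leaf_set b \<Longrightarrow> color (BNode l a b) r k v =
      color b (rainbow_right r l a b) (right_offset r l a b k) v"
  using assms by auto

lemma color_join:
  assumes t: "disjoint_leaves (BNode Oplus a b)" and f: "f = color (BNode Oplus a b) r k"
  shows "f ` leaf_set a \<inter> f ` leaf_set b = {}"
    and "inj_on f (leaf_set a) \<or> inj_on f (leaf_set b)"
proof -
  let ?ra = "rainbow_left r Oplus a b" and ?rb = "rainbow_right r Oplus a b"
  let ?kb = "right_offset r Oplus a b k"
  note f_v = color_BNode[OF t, of _ r k, folded f]
  have disj: "disjoint_leaves a" "disjoint_leaves b" using t by simp_all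
  have "f ` leaf_set a = color a ?ra k ` leaf_set a"
    "f ` leaf_set b = color b ?rb ?kb ` leaf_set b"
    using f_v by (auto intro!: image_cong)
  then show "f ` leaf_set a \<inter> f ` leaf_set b = {}"
    by (simp add: color_image disj right_offset_def)
  have "?ra \<or> ?rb" by (auto simp: rainbow_left_def rainbow_right_def)
  then show "inj_on f (leaf_set a) \<or> inj_on f (leaf_set b)"
    using inj_on_color_rainbow disj inj_on_cong[of _ f] f_v by metis
qed

lemma star_coloring_color: "disjoint_leaves t \<Longrightarrow> star_coloring (graph_of t) (color t r k)"
proof (induction t arbitrary: r k)
  case (BLeaf x)
  then show ?case
    using star_coloring_iff[OF simple_graph_graph_of[of "BLeaf x"]]
    by (simp add: proper_coloring_def)
next
  case (BNode l a b)
  define f where "f = color (BNode l a b) r k"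
  have disj: "disjoint_leaves a" "disjoint_leaves b" "leaf_set a \<inter> leaf_set b = {}"
    using BNode.prems by simp_all
  note simple = simple_graph_graph_of[OF disj(1)] simple_graph_graph_of[OF disj(2)]
  have star: "star_coloring (graph_of a) f" "star_coloring (graph_of b) f"
    using BNode.IH disj(1,2) color_BNode[OF BNode.prems, of _ r k, folded f_def]
      star_coloring_cong[OF simple(1)] star_coloring_cong[OF simple(2)]
    by (metis verts_graph_of)+
  have "star_coloring (graph_of (BNode l a b)) f"
  proof (cases l)
    case Cup
    then show ?thesis
      using star_coloring_union[of "graph_of a" f "graph_of b"] star simple disj(3) by simp
  next
    case Oplus
    note join = color_join[OF BNode.prems[unfolded Oplus] f_def[unfolded Oplus]]
    from join(2) show ?thesis
    proof
      assume "inj_on f (leaf_set a)"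
      then show ?thesis
        using star_coloring_join[OF simple(2) star(2) simple(1)] join(1) disj(3) Oplus
          graph_join_commute[of "graph_of a"] by (simp add: Int_commute)
    next
      assume "inj_on f (leaf_set b)"
      then show ?thesis
        using star_coloring_join[OF simple(1) star(1) simple(2)] join(1) disj(3) Oplus by simp
    qed
  qed
  then show ?case unfolding f_def .
qed

lemma color_optimal:
  assumes t: "disjoint_leaves t" and f: "\<And>v. v \<in> leaf_set t \<Longrightarrow> f v = color t False 0 v"
  shows "optimal_acyclic_coloring (graph_of t) f" and "optimal_star_coloring (graph_of t) f"
proof -
  have star: "star_coloring (graph_of t) f"
    using star_coloring_color[OF t] star_coloring_cong[OF simple_graph_graph_of[OF t]] f
    by (metis verts_graph_of)
  have "f ` leaf_set t = color t False 0 ` leaf_set t"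
    using f by (rule image_cong[OF refl])
  then have "num_colors (graph_of t) f = chi t"
    by (simp add: num_colors_def color_image[OF t] ncolors_def)
  then have "num_colors (graph_of t) f \<le> num_colors (graph_of t) g"
    if "acyclic_coloring (graph_of t) g" for g
    using chi_le_num_colors[OF t that] by simp
  then show "optimal_acyclic_coloring (graph_of t) f" "optimal_star_coloring (graph_of t) f"
    using optimal_coloringsI[OF star] by blast+
qed

section \<open>Executions of bounded cost\<close>

definition exec_within :: "nat \<Rightarrow> com \<Rightarrow> state \<Rightarrow> nat \<Rightarrow> state \<Rightarrow> bool" where
  "exec_within w P s c s' \<longleftrightarrow> (\<exists>t\<le>c. exec w P s t s')"

lemma exec_withinI: "exec w P s t s' \<Longrightarrow> t \<le> c \<Longrightarrow> exec_within w P s c s'"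
  unfolding exec_within_def by blast

lemma exec_within_Seq:
  assumes "exec_within w P s c s'" and "exec_within w Q s' d s''"
  shows "exec_within w (Seq P Q) s (c + d + 1) s''"
proof -
  obtain t t' where t: "t \<le> c" "exec w P s t s'" and t': "t' \<le> d" "exec w Q s' t' s''"
    using assms unfolding exec_within_def by blast
  have "t + t' + 1 \<le> c + d + 1" using t(1) t'(1) by linarith
  then show ?thesis by (rule exec_withinI[OF exec.Seq[OF t(2) t'(2)]])
qed

lemma exec_within_If:
  assumes "exec_within w (if bval w b s then P else Q) s c s'"
  shows "exec_within w (If b P Q) s (bcost b + c + 1) s'"
proof -
  obtain t where t: "t \<le> c" "exec w (if bval w b s then P else Q) s t s'"
    using assms unfolding exec_within_def by blast
  then have "exec w (If b P Q) s (bcost b + t + 1) s'"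
    by (cases "bval w b s") (metis exec.IfTrue, metis exec.IfFalse)
  moreover have "bcost b + t + 1 \<le> bcost b + c + 1" using t(1) by linarith
  ultimately show ?thesis by (rule exec_withinI)
qed

lemma exec_within_While:
  assumes step: "\<And>s. I s \<Longrightarrow> bval w b s \<Longrightarrow> \<exists>s'. exec_within w P s c s' \<and> I s' \<and> m s' < m s"
    and "I s"
  shows "\<exists>s'. exec_within w (While b P) s ((m s + 1) * (bcost b + c + 1)) s' \<and> I s' \<and> \<not> bval w b s'"
  using \<open>I s\<close>
proof (induction "m s" arbitrary: s rule: less_induct)
  case less
  let ?c = "bcost b + c + 1"
  show ?case
  proof (cases "bval w b s")
    case False
    then have "exec_within w (While b P) s ((m s + 1) * ?c) s"
      by (intro exec_withinI[OF exec.WhileFalse]) simp_all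
    with False less.prems show ?thesis by blast
  next
    case True
    obtain s' t where body: "t \<le> c" "exec w P s t s'" and s': "I s'" "m s' < m s"
      using step[OF less.prems True] unfolding exec_within_def by blast
    obtain s'' t' where loop: "t' \<le> (m s' + 1) * ?c" "exec w (While b P) s' t' s''"
      and s'': "I s''" "\<not> bval w b s''"
      using less.hyps[OF s'(2,1)] unfolding exec_within_def by blast
    have "(m s' + 1) * ?c \<le> m s * ?c" using s'(2) by (intro mult_le_mono1) simp
    then have "bcost b + t + t' + 1 \<le> (m s + 1) * ?c" using body(1) loop(1) by simp
    then have "exec_within w (While b P) s ((m s + 1) * ?c) s''"
      by (rule exec_withinI[OF exec.WhileTrue[OF True body(2) loop(2)]])
    with s'' show ?thesis by blast
  qed
qed

primrec loop_free :: "com \<Rightarrow> bool" where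
  "loop_free Skip \<longleftrightarrow> True"
| "loop_free (Assign r e) \<longleftrightarrow> True"
| "loop_free (Put a d e) \<longleftrightarrow> True"
| "loop_free (Seq P Q) \<longleftrightarrow> loop_free P \<and> loop_free Q"
| "loop_free (If b P Q) \<longleftrightarrow> loop_free P \<and> loop_free Q"
| "loop_free (While b P) \<longleftrightarrow> False"

text \<open>The values of \<open>max_cost\<close> and \<open>run\<close> on loops are junk.\<close>

primrec max_cost :: "com \<Rightarrow> nat" where
  "max_cost Skip = 1"
| "max_cost (Assign r e) = acost e + 1"
| "max_cost (Put a d e) = acost d + acost e + 1"
| "max_cost (Seq P Q) = max_cost P + max_cost Q + 1"
| "max_cost (If b P Q) = bcost b + max (max_cost P) (max_cost Q) + 1"
| "max_cost (While b P) = 0"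

primrec run :: "nat \<Rightarrow> com \<Rightarrow> state \<Rightarrow> state" where
  "run w Skip s = s"
| "run w (Assign r e) s = set_reg r (aval w e s) s"
| "run w (Put a d e) s = set_arr a (aval w d s) (aval w e s) s"
| "run w (Seq P Q) s = run w Q (run w P s)"
| "run w (If b P Q) s = (if bval w b s then run w P s else run w Q s)"
| "run w (While b P) s = s"

lemma exec_within_mono: "exec_within w P s c s' \<Longrightarrow> c \<le> d \<Longrightarrow> exec_within w P s d s'"
  unfolding exec_within_def by (meson order_trans)

lemma exec_within_run: "loop_free P \<Longrightarrow> exec_within w P s (max_cost P) (run w P s)"
proof (induction P arbitrary: s)
  case (If b P Q)
  then have "exec_within w (if bval w b s then P else Q) s (max (max_cost P) (max_cost Q))
      (run w (If b P Q) s)"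
    by (auto intro: exec_within_mono[OF _ max.cobounded1] exec_within_mono[OF _ max.cobounded2])
  then show ?case using exec_within_If[of w b s P Q] by simp
next
  case (Seq P Q)
  then show ?case by (auto intro: exec_within_Seq[simplified])
next
  case Skip
  show ?case using exec_withinI[OF exec.Skip] by simp
next
  case (Assign r e)
  show ?case using exec_withinI[OF exec.Assign] by simp
next
  case (Put a d e)
  show ?case using exec_withinI[OF exec.Put] by simp
qed simp

lemma exec_within_While_loop_free:
  assumes "loop_free P" and "I s"
    and step: "\<And>s. I s \<Longrightarrow> bval w b s \<Longrightarrow> I (run w P s) \<and> m (run w P s) < m s"
    and "m s \<le> n"
  obtains s' where "exec_within w (While b P) s ((n + 1) * (bcost b + max_cost P + 1)) s'"
    and "I s'" and "\<not> bval w b s'"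
proof -
  obtain s' where s': "exec_within w (While b P) s ((m s + 1) * (bcost b + max_cost P + 1)) s'"
    "I s'" "\<not> bval w b s'"
    using exec_within_While[of I w b P "max_cost P" m s] exec_within_run[OF assms(1)] step \<open>I s\<close>
    by blast
  have "(m s + 1) * (bcost b + max_cost P + 1) \<le> (n + 1) * (bcost b + max_cost P + 1)"
    using \<open>m s \<le> n\<close> by (intro mult_le_mono1) simp
  with s' that show thesis using exec_within_mono by blast
qed

lemma set_reg_simps [simp]:
  "regs (set_reg r x s) = (regs s)(r := x)" "arrs (set_reg r x s) = arrs s"
  by (simp_all add: set_reg_def)

lemma set_arr_simps [simp]:
  "arrs (set_arr a i x s) = (arrs s)(a := (arrs s a)(i := x))" "regs (set_arr a i x s) = regs s"
  by (simp_all add: set_arr_def)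

section \<open>Nodes in preorder\<close>

primrec root_code :: "nat bcotree \<Rightarrow> nat" where
  "root_code (BLeaf v) = v + 2"
| "root_code (BNode l a b) = label_code l"

text \<open>The calls made by \<open>color t r k\<close>, in the order of the codes of the nodes in the input.\<close>

primrec preorder :: "'a bcotree \<Rightarrow> bool \<Rightarrow> nat \<Rightarrow> ('a bcotree \<times> bool \<times> nat) list" where
  "preorder (BLeaf v) r k = [(BLeaf v, r, k)]"
| "preorder (BNode l a b) r k = (BNode l a b, r, k) #
     preorder a (rainbow_left r l a b) k @
     preorder b (rainbow_right r l a b) (right_offset r l a b k)"

definition child :: "('a bcotree \<times> bool \<times> nat) list \<Rightarrow> nat \<Rightarrow> nat \<Rightarrow> bool" where
  "child xs p q \<longleftrightarrow> (\<exists>l a b r k. xs ! p = (BNode l a b, r, k) \<and> (q = Suc p \<or> q = p + 2 * order a))"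

lemma encode_cotree_of: "encode (cotree_of t) = map (root_code \<circ> fst) (preorder t r k)"
  by (induction t arbitrary: r k) auto

lemma Suc_length_preorder: "Suc (length (preorder t r k)) = 2 * order t"
  by (induction t arbitrary: r k) (auto simp flip: add_Suc)

lemma preorder_neq_Nil [simp]: "preorder t r k \<noteq> []"
  by (cases t) auto

lemma nth_preorder_0 [simp]: "preorder t r k ! 0 = (t, r, k)"
  by (cases t) auto

lemma drop_preorder:
  "preorder t r k ! p = (u, r', k') \<Longrightarrow> p < length (preorder t r k) \<Longrightarrow>
     \<exists>xs. drop p (preorder t r k) = preorder u r' k' @ xs"
proof (induction t arbitrary: r k p)
  case (BLeaf v)
  then show ?case by simp
next
  case (BNode l a b)
  let ?as = "preorder a (rainbow_left r l a b) k"
  consider (root) "p = 0" | (left) q where "p = Suc q" "q < length ?as"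
    | (right) q where "p = Suc (length ?as + q)"
    by (metis add_diff_inverse_nat not0_implies_Suc)
  then show ?case
  proof cases
    case root
    with BNode.prems show ?thesis by auto
  next
    case left
    with BNode.prems obtain xs where "drop q ?as = preorder u r' k' @ xs"
      using BNode.IH(1)[of "rainbow_left r l a b" k q] by (auto simp: nth_append)
    with left show ?thesis by simp
  next
    case right
    with BNode.prems show ?thesis
      using BNode.IH(2)[of "rainbow_right r l a b" "right_offset r l a b k" q] by simp
  qed
qed

lemma preorder_children:
  assumes "preorder t r k ! p = (BNode l a b, r', k')" and "p < length (preorder t r k)"
  shows "preorder t r k ! Suc p = (a, rainbow_left r' l a b, k')"
    and "preorder t r k ! (p + 2 * order a) = (b, rainbow_right r' l a b, right_offset r' l a b k')"
    and "p + 2 * order a < length (preorder t r k)"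
proof -
  let ?as = "preorder a (rainbow_left r' l a b) k'"
  let ?bs = "preorder b (rainbow_right r' l a b) (right_offset r' l a b k')"
  obtain xs where drop: "drop p (preorder t r k) = (BNode l a b, r', k') # ?as @ ?bs @ xs"
    using drop_preorder[OF assms] by auto
  have nth: "preorder t r k ! (p + i) = ((BNode l a b, r', k') # ?as @ ?bs @ xs) ! i" for i
    using assms(2) by (simp flip: drop)
  show "preorder t r k ! Suc p = (a, rainbow_left r' l a b, k')"
    using nth[of 1] by (simp add: nth_append)
  have len: "2 * order a = Suc (length ?as)"
    by (simp only: Suc_length_preorder)
  show "preorder t r k ! (p + 2 * order a) = (b, rainbow_right r' l a b, right_offset r' l a b k')"
    using nth[of "2 * order a"] unfolding len by (simp add: nth_append)
  have "length (preorder t r k) - p = Suc (length ?as + length ?bs + length xs)"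
    using arg_cong[OF drop, of length] by simp
  moreover have "0 < length ?bs" by simp
  ultimately show "p + 2 * order a < length (preorder t r k)"
    unfolding len by linarith
qed

lemma child_preorder_left:
  assumes "child (preorder a (rainbow_left r l a b) k) p q"
    and "p < length (preorder a (rainbow_left r l a b) k)"
  shows "child (preorder (BNode l a b) r k) (Suc p) (Suc q)"
  using assms by (auto simp: child_def nth_append)

lemma child_preorder_right:
  assumes "child (preorder b (rainbow_right r l a b) (right_offset r l a b k)) p q"
  shows "child (preorder (BNode l a b) r k) (2 * order a + p) (2 * order a + q)"
  using assms unfolding Suc_length_preorder[of a "rainbow_left r l a b" k, symmetric]
  by (auto simp: child_def nth_append)

lemma preorder_parent:
  "0 < q \<Longrightarrow> q < length (preorder t r k) \<Longrightarrow> \<exists>p<q. child (preorder t r k) p q"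
proof (induction t arbitrary: r k q)
  case (BLeaf v)
  then show ?case by simp
next
  case (BNode l a b)
  let ?as = "preorder a (rainbow_left r l a b) k"
  let ?bs = "preorder b (rainbow_right r l a b) (right_offset r l a b k)"
  have as: "2 * order a = Suc (length ?as)" by (simp only: Suc_length_preorder)
  consider (root) "q = Suc 0 \<or> q = 2 * order a"
    | (left) i where "q = Suc i" "0 < i" "i < length ?as"
    | (right) i where "q = 2 * order a + i" "0 < i"
    unfolding as using BNode.prems(1)
    by (metis Suc_less_eq add.right_neutral gr0I gr0_implies_Suc less_imp_add_positive
        not_less_iff_gr_or_eq)
  then show ?case
  proof cases
    case root
    then have "child (preorder (BNode l a b) r k) 0 q" by (auto simp: child_def)
    with BNode.prems(1) show ?thesis by blast
  next
    case left
    then obtain p where "p < i" "child ?as p i" using BNode.IH(1) by blast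
    with left show ?thesis
      using child_preorder_left[of a r l b k p i] by (intro exI[of _ "Suc p"]) simp
  next
    case right
    then have "i < length ?bs" using BNode.prems(2) as by simp
    with right obtain p where "p < i" "child ?bs p i" using BNode.IH(2) by blast
    with right show ?thesis
      using child_preorder_right[of b r l a k p i]
      by (intro exI[of _ "2 * order a + p"]) simp
  qed
qed

lemma preorder_bounds:
  "(u, r', k') \<in> set (preorder t r k) \<Longrightarrow>
     order u \<le> order t \<and> k' + ncolors r' u \<le> k + ncolors r t"
proof (induction t arbitrary: r k)
  case (BLeaf v)
  then show ?case by simp
next
  case (BNode l a b)
  from BNode.prems consider "(u, r', k') = (BNode l a b, r, k)"
    | "(u, r', k') \<in> set (preorder a (rainbow_left r l a b) k)"
    | "(u, r', k') \<in> set (preorder b (rainbow_right r l a b) (right_offset r l a b k))"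
    by auto
  then show ?case
    unfolding ncolors_BNode by cases (auto dest!: BNode.IH simp: ncolors_BNode)
qed

lemma color_preorder_BLeaf:
  "disjoint_leaves t \<Longrightarrow> (BLeaf v, r', k') \<in> set (preorder t r k) \<Longrightarrow>
     v \<in> leaf_set t \<and> color t r k v = k'"
proof (induction t arbitrary: r k)
  case (BLeaf x)
  then show ?case by simp
next
  case (BNode l a b)
  from BNode.prems(2)
  consider (left) "(BLeaf v, r', k') \<in> set (preorder a (rainbow_left r l a b) k)"
    | (right) "(BLeaf v, r', k') \<in>
        set (preorder b (rainbow_right r l a b) (right_offset r l a b k))"
    by auto
  then show ?case
  proof cases
    case left
    then show ?thesis using BNode.IH(1) BNode.prems(1) by simp
  next
    case right
    then have "v \<in> leaf_set b \<and> color b (rainbow_right r l a b) (right_offset r l a b k) v = k'"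
      using BNode.IH(2) BNode.prems(1) by simp
    then show ?thesis using BNode.prems(1) by auto
  qed
qed

lemma leaf_set_imp_preorder: "v \<in> leaf_set t \<Longrightarrow> \<exists>r' k'. (BLeaf v, r', k') \<in> set (preorder t r k)"
  by (induction t arbitrary: r k) (simp, simp, blast)

section \<open>The program\<close>

text \<open>The cell of a node in array \<open>2\<close> receives the order of its subtree, in array \<open>3\<close> the value of
  \<open>chi\<close>, in arrays \<open>4\<close> and \<open>5\<close> the arguments \<open>k\<close> and \<open>r\<close> of its call of \<open>color\<close>.\<close>

abbreviation current :: aexp where
  "current \<equiv> Reg 0"

abbreviation order_at :: "aexp \<Rightarrow> aexp" where
  "order_at e \<equiv> Get 2 e"

abbreviation chi_at :: "aexp \<Rightarrow> aexp" where
  "chi_at e \<equiv> Get 3 e"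

abbreviation offset_at :: "aexp \<Rightarrow> aexp" where
  "offset_at e \<equiv> Get 4 e"

abbreviation rainbow_at :: "aexp \<Rightarrow> aexp" where
  "rainbow_at e \<equiv> Get 5 e"

abbreviation left_child :: aexp where
  "left_child \<equiv> Add current (Const 1)"

abbreviation right_child :: aexp where
  "right_child \<equiv> Add current (Add (order_at left_child) (order_at left_child))"

definition put_max :: "nat \<Rightarrow> aexp \<Rightarrow> aexp \<Rightarrow> aexp \<Rightarrow> com" where
  "put_max a i d e = If (Less d e) (Put a i e) (Put a i d)"

definition put_min :: "nat \<Rightarrow> aexp \<Rightarrow> aexp \<Rightarrow> aexp \<Rightarrow> com" where
  "put_min a i d e = If (Less d e) (Put a i d) (Put a i e)"

definition tabulate_step :: com where
  "tabulate_step =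
     Seq (Assign 0 (Sub current (Const 1)))
     (If (Less (Get 0 current) (Const 2))
       (Seq (Put 2 current (Add (order_at left_child) (order_at right_child)))
       (If (Equal (Get 0 current) (Const 0))
         (put_max 3 current (chi_at left_child) (chi_at right_child))
         (put_min 3 current
           (Add (chi_at left_child) (order_at right_child))
           (Add (chi_at right_child) (order_at left_child)))))
       (Seq (Put 2 current (Const 1)) (Put 3 current (Const 1))))"

definition put_children :: "bool \<Rightarrow> bool \<Rightarrow> aexp \<Rightarrow> com" where
  "put_children ra rb kb =
     Seq (Put 4 left_child (offset_at current))
     (Seq (Put 4 right_child kb)
     (Seq (Put 5 left_child (Const (of_bool ra)))
     (Put 5 right_child (Const (of_bool rb)))))"

definition color_step :: com where
  "color_step =
     Seq
     (If (Less (Get 0 current) (Const 2))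
       (If (Equal (rainbow_at current) (Const 1))
         (put_children True True (Add (offset_at current) (order_at left_child)))
       (If (Equal (Get 0 current) (Const 0))
         (put_children False False (offset_at current))
       (If (Less (Add (chi_at left_child) (order_at right_child))
             (Add (chi_at right_child) (order_at left_child)))
         (put_children False True (Add (offset_at current) (chi_at left_child)))
         (put_children True False (Add (offset_at current) (order_at left_child))))))
       (Put 1 (Sub (Get 0 current) (Const 2)) (offset_at current)))
     (Assign 0 (Add current (Const 1)))"

definition coloring_program :: com where
  "coloring_program =
     Seq (Assign 1 (Reg 0))
     (Seq (While (Less (Const 0) current) tabulate_step)
     (While (Less current (Reg 1)) color_step))"

lemma loop_free_tabulate_step: "loop_free tabulate_step"
  by (simp add: tabulate_step_def put_max_def put_min_def)

lemma loop_free_color_step: "loop_free color_step"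
  by (simp add: color_step_def put_children_def)

lemma label_code_less_2 [simp]: "label_code l < 2"
  by (cases l) simp_all

lemma run_put_max:
  "run w (put_max a i d e) s = set_arr a (aval w i s) (max (aval w d s) (aval w e s)) s"
  by (simp add: put_max_def max_def)

lemma run_put_min:
  "run w (put_min a i d e) s = set_arr a (aval w i s) (min (aval w d s) (aval w e s)) s"
  by (simp add: put_min_def min_def)

lemma run_tabulate_step_BLeaf:
  assumes "regs s 0 = Suc i" and "arrs s 0 i = root_code (BLeaf v)" and "(2::nat) < 2 ^ w"
  shows "regs (run w tabulate_step s) = (regs s)(0 := i)"
    and "arrs (run w tabulate_step s) = (arrs s)
      (2 := (arrs s 2)(i := order (BLeaf v)), 3 := (arrs s 3)(i := chi (BLeaf v)))"
proof -
  have "0 < w" using assms(3) by (cases w) simp_all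
  with assms show "regs (run w tabulate_step s) = (regs s)(0 := i)"
    and "arrs (run w tabulate_step s) = (arrs s)
      (2 := (arrs s 2)(i := order (BLeaf v)), 3 := (arrs s 3)(i := chi (BLeaf v)))"
    by (simp_all add: tabulate_step_def)
qed

lemma run_tabulate_step_BNode:
  assumes "regs s 0 = Suc i" and "arrs s 0 i = root_code (BNode l a b)" and "(2::nat) < 2 ^ w"
    and "arrs s 2 (Suc i) = order a" and "arrs s 3 (Suc i) = chi a"
    and "arrs s 2 (i + 2 * order a) = order b" and "arrs s 3 (i + 2 * order a) = chi b"
    and "i + 2 * order a < 2 ^ w" and "order (BNode l a b) < 2 ^ w"
  shows "regs (run w tabulate_step s) = (regs s)(0 := i)"
    and "arrs (run w tabulate_step s) = (arrs s)
      (2 := (arrs s 2)(i := order (BNode l a b)), 3 := (arrs s 3)(i := chi (BNode l a b)))"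
proof -
  have bounds: "Suc i < 2 ^ w" "chi a + order b < 2 ^ w" "chi b + order a < 2 ^ w"
    using assms(8,9) chi_le_order[of a] chi_le_order[of b] order_pos[of a]
    unfolding order.simps by linarith+
  have w: "0 < w" using assms(3) by (cases w) simp_all
  show "regs (run w tabulate_step s) = (regs s)(0 := i)"
    using assms bounds w by (simp add: tabulate_step_def run_put_max run_put_min)
  show "arrs (run w tabulate_step s) = (arrs s)
      (2 := (arrs s 2)(i := order (BNode l a b)), 3 := (arrs s 3)(i := chi (BNode l a b)))"
    using assms bounds w
    by (cases l) (simp_all add: tabulate_step_def run_put_max run_put_min flip: mult_2)
qed

lemma run_put_children:
  assumes "regs s 0 = i" and "arrs s 2 (Suc i) = n" and "Suc i < 2 ^ w" and "i + 2 * n < 2 ^ w"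
  shows "run w (put_children ra rb e) s =
    set_arr 5 (i + 2 * n) (of_bool rb) (set_arr 5 (Suc i) (of_bool ra)
      (set_arr 4 (i + 2 * n) (aval w e (set_arr 4 (Suc i) (arrs s 4 i) s))
        (set_arr 4 (Suc i) (arrs s 4 i) s)))"
proof -
  have "0 < w" using assms(3) by (cases w) simp_all
  with assms show ?thesis
    by (cases ra; cases rb; simp add: put_children_def flip: mult_2)
qed

lemma regs_run_put_children [simp]: "regs (run w (put_children ra rb e) s) = regs s"
  by (simp add: put_children_def)

lemma run_color_step_BLeaf:
  assumes "regs s 0 = i" and "arrs s 0 i = root_code (BLeaf v)"
    and "(2::nat) < 2 ^ w" and "Suc i < 2 ^ w"
  shows "regs (run w color_step s) = (regs s)(0 := Suc i)"
    and "arrs (run w color_step s) = (arrs s)(1 := (arrs s 1)(v := arrs s 4 i))"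
proof -
  have "0 < w" using assms(3) by (cases w) simp_all
  with assms show "regs (run w color_step s) = (regs s)(0 := Suc i)"
    and "arrs (run w color_step s) = (arrs s)(1 := (arrs s 1)(v := arrs s 4 i))"
    by (simp_all add: color_step_def)
qed

lemma run_color_step_BNode:
  assumes "regs s 0 = i" and "arrs s 0 i = root_code (BNode l a b)" and "(2::nat) < 2 ^ w"
    and "arrs s 2 (Suc i) = order a" and "arrs s 3 (Suc i) = chi a"
    and "arrs s 2 (i + 2 * order a) = order b" and "arrs s 3 (i + 2 * order a) = chi b"
    and "arrs s 4 i = k" and "arrs s 5 i = of_bool r"
    and "i + 2 * order a < 2 ^ w" and "order (BNode l a b) < 2 ^ w"
    and "right_offset r l a b k < 2 ^ w"
  shows "regs (run w color_step s) = (regs s)(0 := Suc i)"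
    and "arrs (run w color_step s) = (arrs s)
      (4 := (arrs s 4)(Suc i := k, i + 2 * order a := right_offset r l a b k),
       5 := (arrs s 5)(Suc i := of_bool (rainbow_left r l a b),
         i + 2 * order a := of_bool (rainbow_right r l a b)))"
proof -
  have bounds: "Suc i < 2 ^ w" "chi a + order b < 2 ^ w" "chi b + order a < 2 ^ w"
    using assms(10,11) chi_le_order[of a] chi_le_order[of b] order_pos[of a]
    unfolding order.simps by linarith+
  have w: "0 < w" using assms(3) by (cases w) simp_all
  note children = run_put_children[OF assms(1,4) bounds(1) assms(10)]
  show "regs (run w color_step s) = (regs s)(0 := Suc i)"
    using assms(1-3) bounds(1) w by (simp add: color_step_def)
  consider r | "\<not> r" "l = Cup" | "\<not> r" "l = Oplus" "chi a + order b < chi b + order a"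
    | "\<not> r" "l = Oplus" "chi b + order a \<le> chi a + order b"
    by (meson label.exhaust not_less)
  then show "arrs (run w color_step s) = (arrs s)
      (4 := (arrs s 4)(Suc i := k, i + 2 * order a := right_offset r l a b k),
       5 := (arrs s 5)(Suc i := of_bool (rainbow_left r l a b),
         i + 2 * order a := of_bool (rainbow_right r l a b)))"
    using assms bounds w
    by cases (simp_all add: color_step_def children color_defs flip: mult_2)
qed

section \<open>Correctness of the program\<close>

context
  fixes t :: "nat bcotree" and w :: nat
  assumes disjoint: "disjoint_leaves t" and word: "4 * order t \<le> 2 ^ w"
begin

abbreviation nodes :: "(nat bcotree \<times> bool \<times> nat) list" where
  "nodes \<equiv> preorder t False 0"

definition input_kept :: "state \<Rightarrow> bool" where
  "input_kept s \<longleftrightarrow> regs s 1 = length nodes \<and>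
     (\<forall>p<length nodes. arrs s 0 p = root_code (fst (nodes ! p)))"

definition tabulated :: "nat \<Rightarrow> state \<Rightarrow> bool" where
  "tabulated i s \<longleftrightarrow> (\<forall>p. i \<le> p \<and> p < length nodes \<longrightarrow>
     arrs s 2 p = order (fst (nodes ! p)) \<and> arrs s 3 p = chi (fst (nodes ! p)))"

definition annotated :: "nat \<Rightarrow> state \<Rightarrow> bool" where
  "annotated i s \<longleftrightarrow> (\<forall>p. p = 0 \<or> (\<exists>q<i. child nodes q p) \<longrightarrow>
     arrs s 4 p = snd (snd (nodes ! p)) \<and> arrs s 5 p = of_bool (fst (snd (nodes ! p))))"

definition colored :: "nat \<Rightarrow> state \<Rightarrow> bool" where
  "colored i s \<longleftrightarrow>
     (\<forall>p<i. \<forall>v r k. nodes ! p = (BLeaf v, r, k) \<longrightarrow> arrs s 1 v = color t False 0 v)"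

definition tabulate_invariant :: "state \<Rightarrow> bool" where
  "tabulate_invariant s \<longleftrightarrow> regs s 0 \<le> length nodes \<and> input_kept s \<and> tabulated (regs s 0) s \<and>
     annotated 0 s"

definition color_invariant :: "state \<Rightarrow> bool" where
  "color_invariant s \<longleftrightarrow> regs s 0 \<le> length nodes \<and> input_kept s \<and> tabulated 0 s \<and>
     annotated (regs s 0) s \<and> colored (regs s 0) s"

lemma two_less_word: "2 < (2::nat) ^ w"
  using word order_pos[of t] by linarith

lemma length_nodes: "2 * length nodes < 2 ^ w"
  using word Suc_length_preorder[of t False 0] by linarith

lemma node_bounds:
  assumes "nodes ! p = (u, r, k)" and "p < length nodes"
  shows "order u < 2 ^ w" and "k + ncolors r u < 2 ^ w"
proof -
  have "(u, r, k) \<in> set nodes" using assms by (metis nth_mem)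
  then have "order u \<le> order t \<and> k + ncolors r u \<le> 0 + ncolors False t"
    by (rule preorder_bounds)
  moreover have "order t < 2 ^ w" using word order_pos[of t] by linarith
  ultimately show "order u < 2 ^ w" "k + ncolors r u < 2 ^ w"
    using ncolors_le_order[of False t] by linarith+
qed

lemma tabulated_children:
  assumes "nodes ! p = (BNode l a b, r, k)" and "p < length nodes" and "tabulated (Suc p) s"
  shows "arrs s 2 (Suc p) = order a" and "arrs s 3 (Suc p) = chi a"
    and "arrs s 2 (p + 2 * order a) = order b" and "arrs s 3 (p + 2 * order a) = chi b"
proof -
  note children = preorder_children[OF assms(1,2)]
  have "Suc p \<le> p + 2 * order a" using order_pos[of a] by linarith
  with children assms(3)
  show "arrs s 2 (p + 2 * order a) = order b" and "arrs s 3 (p + 2 * order a) = chi b"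
    and "arrs s 2 (Suc p) = order a" "arrs s 3 (Suc p) = chi a"
    by (simp_all add: tabulated_def)
qed

lemma run_tabulate_step:
  assumes s: "tabulate_invariant s" and i: "regs s 0 = Suc i" and node: "nodes ! i = (u, r, k)"
  shows "regs (run w tabulate_step s) = (regs s)(0 := i)"
    and "arrs (run w tabulate_step s) =
      (arrs s)(2 := (arrs s 2)(i := order u), 3 := (arrs s 3)(i := chi u))"
proof -
  have less: "i < length nodes" and input: "arrs s 0 i = root_code u" and "tabulated (Suc i) s"
    using s i node by (auto simp: tabulate_invariant_def input_kept_def)
  have "regs (run w tabulate_step s) = (regs s)(0 := i) \<and> arrs (run w tabulate_step s) =
      (arrs s)(2 := (arrs s 2)(i := order u), 3 := (arrs s 3)(i := chi u))"
  proof (cases u)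
    case (BLeaf v)
    then show ?thesis
      using run_tabulate_step_BLeaf[OF i _ two_less_word] input by simp
  next
    case (BNode l a b)
    have "i + 2 * order a < 2 ^ w"
      using preorder_children(3)[OF node[unfolded BNode] less] length_nodes by linarith
    then show ?thesis
      using run_tabulate_step_BNode[OF i input[unfolded BNode] two_less_word
          tabulated_children[OF node[unfolded BNode] less \<open>tabulated (Suc i) s\<close>]]
        node_bounds(1)[OF node less] BNode by blast
  qed
  then show "regs (run w tabulate_step s) = (regs s)(0 := i)"
    and "arrs (run w tabulate_step s) =
      (arrs s)(2 := (arrs s 2)(i := order u), 3 := (arrs s 3)(i := chi u))" by blast+
qed

lemma tabulate_step_invariant:
  assumes s: "tabulate_invariant s" and "bval w (Less (Const 0) current) s"
  shows "tabulate_invariant (run w tabulate_step s) \<and> regs (run w tabulate_step s) 0 < regs s 0"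
proof -
  obtain i where i: "regs s 0 = Suc i" using assms(2) gr0_implies_Suc by auto
  obtain u r k where node: "nodes ! i = (u, r, k)" by (metis surj_pair)
  note run = run_tabulate_step[OF s i node]
  have "tabulated (Suc i) s" using s i by (simp add: tabulate_invariant_def)
  then have "tabulated i (run w tabulate_step s)"
    using node by (simp add: tabulated_def run)
  then show ?thesis
    using s i by (auto simp: tabulate_invariant_def input_kept_def annotated_def run)
qed

lemma annotated_current:
  assumes "annotated i s" and "i < length nodes" and "nodes ! i = (u, r, k)"
  shows "arrs s 4 i = k" and "arrs s 5 i = of_bool r"
proof -
  have "i = 0 \<or> (\<exists>q<i. child nodes q i)" using preorder_parent assms(2) by blast
  then show "arrs s 4 i = k" "arrs s 5 i = of_bool r"
    using assms(1,3) unfolding annotated_def by (metis fst_conv snd_conv)+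
qed

lemma color_invariant_step_BLeaf:
  assumes s: "color_invariant s" and i: "regs s 0 = i" "i < length nodes"
    and node: "nodes ! i = (BLeaf v, r, k)"
  shows "color_invariant (run w color_step s) \<and> regs (run w color_step s) 0 = Suc i"
proof -
  have "arrs s 0 i = root_code (BLeaf v)" "Suc i < 2 ^ w"
    using s i node length_nodes by (auto simp: color_invariant_def input_kept_def)
  note run = run_color_step_BLeaf[OF i(1) this(1) two_less_word this(2)]
  have "(BLeaf v, r, k) \<in> set nodes" using node i(2) by (metis nth_mem)
  then have "arrs s 4 i = color t False 0 v"
    using color_preorder_BLeaf[OF disjoint] annotated_current(1)[OF _ i(2) node] s i(1)
    by (simp add: color_invariant_def)
  then have "colored (Suc i) (run w color_step s)"
    using s i(1) node by (auto simp: colored_def color_invariant_def run less_Suc_eq)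
  moreover have "\<not> child nodes i p" for p using node by (simp add: child_def)
  then have "annotated (Suc i) (run w color_step s)"
    using s i(1) by (simp add: annotated_def color_invariant_def run Ex_less_Suc)
  ultimately show ?thesis
    using s i by (simp add: color_invariant_def input_kept_def tabulated_def run)
qed

lemma color_invariant_step_BNode:
  assumes s: "color_invariant s" and i: "regs s 0 = i" "i < length nodes"
    and node: "nodes ! i = (BNode l a b, r, k)"
  shows "color_invariant (run w color_step s) \<and> regs (run w color_step s) 0 = Suc i"
proof -
  note children = preorder_children[OF node i(2)]
  have input: "arrs s 0 i = root_code (BNode l a b)" and tab: "tabulated (Suc i) s"
    and ann: "annotated i s"
    using s i node by (auto simp: color_invariant_def input_kept_def tabulated_def)
  have "i + 2 * order a < 2 ^ w" "right_offset r l a b k < 2 ^ w"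
    using children(3) length_nodes node_bounds(2)[OF node i(2)] unfolding ncolors_BNode by linarith+
  note run = run_color_step_BNode[OF i(1) input two_less_word tabulated_children[OF node i(2) tab]
      annotated_current[OF ann i(2) node] this(1) node_bounds(1)[OF node i(2)] this(2)]
  have "child nodes i p \<longleftrightarrow> p = Suc i \<or> p = i + 2 * order a" for p
    using node by (simp add: child_def)
  then have "annotated (Suc i) (run w color_step s)"
    using ann children by (auto simp: annotated_def run Ex_less_Suc)
  moreover have "colored (Suc i) (run w color_step s)"
    using s i(1) node by (auto simp: colored_def color_invariant_def run less_Suc_eq)
  ultimately show ?thesis
    using s i by (simp add: color_invariant_def input_kept_def tabulated_def run)
qed

lemma color_step_invariant:
  assumes "color_invariant s" and "bval w (Less current (Reg 1)) s"
  shows "color_invariant (run w color_step s) \<and>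
    length nodes - regs (run w color_step s) 0 < length nodes - regs s 0"
proof -
  have less: "regs s 0 < length nodes"
    using assms by (simp add: color_invariant_def input_kept_def)
  obtain u r k where node: "nodes ! regs s 0 = (u, r, k)" by (metis surj_pair)
  then have "color_invariant (run w color_step s) \<and> regs (run w color_step s) 0 = Suc (regs s 0)"
    using color_invariant_step_BLeaf[OF assms(1) refl less]
      color_invariant_step_BNode[OF assms(1) refl less]
    by (cases u) blast+
  with less show ?thesis by auto
qed

lemma tabulate_invariant_input:
  "tabulate_invariant (set_reg 1 (length nodes) (input_state (encode (cotree_of t))))"
  by (auto simp: tabulate_invariant_def input_kept_def tabulated_def annotated_def
      input_state_def encode_cotree_of[of t False 0])

lemma output_coloring_color:
  assumes s: "color_invariant s" "\<not> bval w (Less current (Reg 1)) s" and "v \<in> leaf_set t"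
  shows "output_coloring s v = color t False 0 v"
proof -
  obtain p r k where "p < length nodes" "nodes ! p = (BLeaf v, r, k)"
    using leaf_set_imp_preorder[OF \<open>v \<in> leaf_set t\<close>] by (metis in_set_conv_nth)
  moreover have "length nodes \<le> regs s 0"
    using s by (simp add: color_invariant_def input_kept_def)
  ultimately show ?thesis
    using s(1) by (auto simp: color_invariant_def colored_def output_coloring_def)
qed

lemma exec_coloring_program:
  "\<exists>s. exec_within w coloring_program (input_state (encode (cotree_of t)))
      (2 * order t * (max_cost tabulate_step + max_cost color_step + 10)) s \<and>
    (\<forall>v\<in>leaf_set t. output_coloring s v = color t False 0 v)"
proof -
  let ?input = "input_state (encode (cotree_of t))"
  let ?b\<^sub>1 = "Less (Const 0) current" and ?b\<^sub>2 = "Less current (Reg 1)"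
  let ?s = "set_reg 1 (length nodes) ?input"
  have nodes: "length nodes + 1 = 2 * order t"
    using Suc_length_preorder[of t False 0] by simp
  have "regs ?input 0 = length nodes"
    by (simp add: input_state_def encode_cotree_of[of t False 0])
  then have init: "exec_within w (Assign 1 (Reg 0)) ?input 2 ?s"
    using exec_withinI[OF exec.Assign[of w 1 "Reg 0" ?input]] by simp
  have start: "tabulate_invariant ?s" "regs ?s 0 \<le> length nodes"
    using tabulate_invariant_input by (simp_all add: tabulate_invariant_def)
  obtain s\<^sub>1 where s\<^sub>1: "exec_within w (While ?b\<^sub>1 tabulate_step) ?s
      ((length nodes + 1) * (bcost ?b\<^sub>1 + max_cost tabulate_step + 1)) s\<^sub>1"
    "tabulate_invariant s\<^sub>1" "\<not> bval w ?b\<^sub>1 s\<^sub>1"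
    by (rule exec_within_While_loop_free[where I = tabulate_invariant and m = "\<lambda>s. regs s 0",
          OF loop_free_tabulate_step start(1) tabulate_step_invariant start(2)])
  then have mid: "color_invariant s\<^sub>1" "length nodes - regs s\<^sub>1 0 \<le> length nodes"
    by (simp_all add: tabulate_invariant_def color_invariant_def colored_def)
  obtain s\<^sub>2 where s\<^sub>2: "exec_within w (While ?b\<^sub>2 color_step) s\<^sub>1
      ((length nodes + 1) * (bcost ?b\<^sub>2 + max_cost color_step + 1)) s\<^sub>2"
    "color_invariant s\<^sub>2" "\<not> bval w ?b\<^sub>2 s\<^sub>2"
    by (rule exec_within_While_loop_free[where I = color_invariant
          and m = "\<lambda>s. length nodes - regs s 0",
          OF loop_free_color_step mid(1) color_step_invariant mid(2)])
  have "exec_within w coloring_program ?input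
      (2 * order t * (max_cost tabulate_step + max_cost color_step + 10)) s\<^sub>2"
    using exec_within_Seq[OF init exec_within_Seq[OF s\<^sub>1(1) s\<^sub>2(1)]] order_pos[of t]
    unfolding coloring_program_def nodes
    by (elim exec_within_mono) (simp add: algebra_simps del: order_pos)
  with output_coloring_color[OF s\<^sub>2(2,3)] show ?thesis by blast
qed

end

theorem theorem6:
  "\<exists>(P :: com) (K :: nat) (time :: nat \<Rightarrow> real).
     time \<in> O(\<lambda>n. real n) \<and>
     (\<forall>(G :: nat graph) (T :: nat cotree) (n :: nat) (w :: nat).
        cograph G \<and> is_cotree T G \<and> binary T \<and> n = card (verts G) \<and>
        K * n \<le> 2 ^ w \<and> (\<forall>x \<in> set (encode T). x < 2 ^ w) \<longrightarrow>
        (\<exists>t s. exec w P (input_state (encode T)) t s \<and> real t \<le> time n \<and>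
           optimal_acyclic_coloring G (output_coloring s) \<and>
           optimal_star_coloring G (output_coloring s)))"
proof -
  define c where "c = 2 * (max_cost tabulate_step + max_cost color_step + 10)"
  have "(\<lambda>n. real (c * n)) \<in> O(\<lambda>n. real n)"
    by (intro bigoI[of _ "real c"]) simp
  moreover have "\<exists>t s. exec w coloring_program (input_state (encode T)) t s \<and>
      real t \<le> real (c * n) \<and> optimal_acyclic_coloring G (output_coloring s) \<and>
      optimal_star_coloring G (output_coloring s)"
    if G: "cograph G" "is_cotree T G" "binary T" and n: "n = card (verts G)" "4 * n \<le> 2 ^ w"
    for G T n w
  proof -
    obtain u where T: "T = cotree_of u" using binary_imp_cotree_of[OF G(3)] by blast
    have u: "disjoint_leaves u" "G = graph_of u"
      using is_cotree_imp_graph_of[of G u] cograph_imp_simple_graph[OF G(1)] G(2) T by blast+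
    then have order: "n = order u" using n(1) card_leaf_set by simp
    obtain t s where "exec w coloring_program (input_state (encode T)) t s" "t \<le> c * n"
      and "\<forall>v\<in>leaf_set u. output_coloring s v = color u False 0 v"
      using exec_coloring_program[OF u(1) n(2)[unfolded order]]
      unfolding exec_within_def T c_def order by (auto simp: ac_simps)
    then show ?thesis using color_optimal[OF u(1)] u(2) by (metis of_nat_mono)
  qed
  ultimately show ?thesis by blast
qed

end
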